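(* Let $p\ge 1$ be an integer and let $w=h+\overline{g}$ be a sense-preserving harmonic mapping of $\mathbb{D}$ (with $h,g$ analytic in $\mathbb{D}$) such that $\mu(0,w)=p$ and $w(\mathbb{D})\subset\mathbb{D}$. Put $a_p=\frac{D^p h(0)}{p!}$ and $b_p=\frac{D^p g(0)}{p!}$. Then for every $z\in\mathbb{D}$, $$|w(z)|\le \frac{4}{\pi}\arctan\left[|z|^p\,\frac{|z|+\frac{\pi}{4}(|a_p|+|b_p|)}{1+\frac{\pi}{4}(|a_p|+|b_p|)|z|}\right].$$
   Context: $\mathbb{D}=\{z\in\mathbb{C}:|z|<1\}$. $D^k$ denotes the $k$-th order derivative with respect to $z$. A complex-valued $w\in C^2(\mathbb{D})$ is harmonic if $4w_{z\bar z}=0$ in $\mathbb{D}$; then $w=h+\overline{g}$ with $h,g$ analytic in $\mathbb{D}$, unique up to additive constants. Its second complex dilatation is $\omega=\overline{w_{\bar z}}/w_z=g'/h'$. The mapping $w$ is sense-preserving if $h'\not\equiv 0$ and $\omega$ (after removing removable singularities at zeros of $h'$) is analytic in $\mathbb{D}$ with $|\omega(z)|<1$ for all $z\in\mathbb{D}$; zeros of the Jacobian at isolated points are allowed. Multiplicity: let $w=h+\overline g$ be sense-preserving harmonic with $w(z_0)=0$, the additive constants being chosen so that $h(z_0)=g(z_0)=0$. Write $h(z)=\sum_{k\ge n}a_k(z-z_0)^k$ and $g(z)=\sum_{k\ge m}b_k(z-z_0)^k$ near $z_0$ with $a_n\ne0$, $b_m\neq 0$ ($m=\infty$ if $g\equiv0$).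 Then, since $|\omega(z_0)|<1$, either $n<m$, or $m=n$ and $|b_n|<|a_n|$. One says $w$ has a zero of order $n$ at $z_0$ and writes $\mu(z_0,w)=n$. *)

theory Defs
  imports "HOL-Complex_Analysis.Complex_Analysis"
begin

definition partial_x :: "(complex \<Rightarrow> complex) \<Rightarrow> complex \<Rightarrow> complex" where
  "partial_x f z = frechet_derivative f (at z) 1"

definition partial_y :: "(complex \<Rightarrow> complex) \<Rightarrow> complex \<Rightarrow> complex" where
  "partial_y f z = frechet_derivative f (at z) \<i>"

definition wirtinger_z :: "(complex \<Rightarrow> complex) \<Rightarrow> complex \<Rightarrow> complex" where
  "wirtinger_z f z = (partial_x f z - \<i> * partial_y f z) / 2"

definition wirtinger_zbar :: "(complex \<Rightarrow> complex) \<Rightarrow> complex \<Rightarrow> complex" where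
  "wirtinger_zbar f z = (partial_x f z + \<i> * partial_y f z) / 2"

(* C^2 in the real sense; meant for open S, where a function with continuous partial
   derivatives is Frechet differentiable. *)
definition C2_on :: "complex set \<Rightarrow> (complex \<Rightarrow> complex) \<Rightarrow> bool" where
  "C2_on S f \<longleftrightarrow>
     f differentiable_on S \<and>
     (\<forall>d \<in> {partial_x, partial_y}.
        d f differentiable_on S \<and>
        (\<forall>e \<in> {partial_x, partial_y}. continuous_on S (e (d f))))"

definition harmonic_mapping_on :: "complex set \<Rightarrow> (complex \<Rightarrow> complex) \<Rightarrow> bool" where
  "harmonic_mapping_on S w \<longleftrightarrow>
     C2_on S w \<and> (\<forall>z\<in>S. 4 * wirtinger_zbar (wirtinger_z w) z = 0)"

definition second_dilatation :: "(complex \<Rightarrow> complex) \<Rightarrow> complex \<Rightarrow> complex" where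
  "second_dilatation w z = cnj (wirtinger_zbar w z) / wirtinger_z w z"

(* om is the dilatation with its singularities at the zeros of w_z removed: outside these
   zeros it is the quotient, and holomorphy forces its values at them. An extension is used
   because the quotient itself evaluates to 0 where w_z = 0. For w = h + cnj g with h, g
   holomorphic, w_z is h' and the quotient is g'/h'. *)
definition sense_preserving_on :: "complex set \<Rightarrow> (complex \<Rightarrow> complex) \<Rightarrow> bool" where
  "sense_preserving_on S w \<longleftrightarrow>
     (\<exists>z\<in>S. wirtinger_z w z \<noteq> 0) \<and>
     (\<exists>om. om holomorphic_on S \<and>
           (\<forall>z\<in>S. wirtinger_z w z \<noteq> 0 \<longrightarrow> om z = second_dilatation w z) \<and>
           (\<forall>z\<in>S. cmod (om z) < 1))"

(* The relation mu(z0, w) = n for sense-preserving harmonic w with w z0 = 0: the additive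
   constants of h and g are normalised to vanish at z0, and n is the index of the first
   nonzero Taylor coefficient of h at z0. For sense-preserving w the expansion of g then
   starts no earlier, so g does not enter the value of n.
   A relation rather than a function is used so that it is false when w z0 is not 0. *)
definition has_zero_of_order ::
  "complex set \<Rightarrow> (complex \<Rightarrow> complex) \<Rightarrow> complex \<Rightarrow> nat \<Rightarrow> bool" where
  "has_zero_of_order S w z0 n \<longleftrightarrow>
     (\<exists>h g. h holomorphic_on S \<and> g holomorphic_on S \<and>
            (\<forall>z\<in>S. w z = h z + cnj (g z)) \<and>
            h z0 = 0 \<and> g z0 = 0 \<and>
            fps_expansion h z0 \<noteq> 0 \<and> subdegree (fps_expansion h z0) = n)"

end

theory Submission
  imports Defs
begin

text \<open>
  Fix a point \<open>z\<close>, rotate the target so that \<open>w z\<close> becomes a nonnegative real number, and look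
  only at real parts. For unimodular \<open>c\<close> the real part of \<open>cnj c * w\<close> equals the real part of the
  analytic function \<open>F = cnj c * h + c * g\<close>, because a conjugate has the same real part; here \<open>h 0 = g 0 = 0\<close>. Hence \<open>F\<close>
  maps the disc into the strip \<open>\<bar>Re \<zeta>\<bar> < 1\<close>, and the bound becomes a Schwarz lemma for analytic
  maps into a strip (\<open>abs_Re_le_arctan_strip\<close>).

  The map \<open>\<zeta> \<mapsto> tan (pi \<zeta> / 4)\<close> takes the strip into the unit disc, fixes 0 and has derivative
  \<open>pi / 4\<close> there. So \<open>tan (pi F / 4) = z ^ p * \<psi> z\<close>, where \<open>\<psi>\<close> is bounded by 1 and \<open>\<psi> 0\<close> is
  \<open>pi / 4\<close> times the \<open>p\<close>-th coefficient of \<open>F\<close>, which has modulus at most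
  \<open>\<bar>a\<^sub>p\<bar> + \<bar>b\<^sub>p\<bar>\<close>. The Schwarz-Pick estimate (\<open>Schwarz_Pick_at_zero\<close>) bounds \<open>\<psi>\<close>, and
  \<open>tan \<bar>Re \<zeta>\<bar> \<le> \<bar>tan \<zeta>\<bar>\<close> (\<open>tan_abs_Re_le\<close>) carries the bound back to the real part of \<open>F\<close>.

  That \<open>F\<close> vanishes to order \<open>p\<close> needs the same of \<open>g\<close>, whereas the order of the zero of \<open>w\<close> is read
  off from \<open>h\<close> alone. This is where sense preservation enters: \<open>g' = \<omega> h'\<close> with \<open>\<omega>\<close> analytic
  (\<open>fps_coanalytic_part_vanishes\<close>).
\<close>

section \<open>Schwarz-type estimates in the unit disc\<close>

lemma holomorphic_factor_power:
  fixes f :: "complex \<Rightarrow> complex"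
  assumes "f holomorphic_on ball 0 r" "r > 0" "f has_fps_expansion A"
    and "\<And>k. k < p \<Longrightarrow> fps_nth A k = 0"
  obtains K where "K holomorphic_on ball 0 r" "\<And>z. z \<in> ball 0 r \<Longrightarrow> f z = z ^ p * K z"
    "K 0 = fps_nth A p"
  using assms
proof (induction p arbitrary: f A thesis)
  case 0
  have "f 0 = fps_nth A 0"
    using fps_nth_fps_expansion[OF "0.prems"(4), of 0] by simp
  then show ?case
    using "0.prems"(1)[of f] "0.prems"(2) by simp
next
  case (Suc p)
  have "f 0 = 0"
    using fps_nth_fps_expansion[OF Suc.prems(4), of 0] Suc.prems(5)[of 0] by simp
  then obtain k where k: "k holomorphic_on ball 0 r" "\<And>z. norm z < r \<Longrightarrow> f z = z * k z"
    using Schwarz3[OF Suc.prems(2)] by metis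
  define B where "B = fps_expansion k 0"
  have B: "k has_fps_expansion B"
    unfolding B_def using k(1) \<open>r > 0\<close> by (intro has_fps_expansion_fps_expansion[of "ball 0 r"]) auto
  have "(\<lambda>z. z * k z) has_fps_expansion fps_X * B"
    by (intro fps_expansion_intros B)
  moreover have "eventually (\<lambda>z. z * k z = f z) (nhds 0)"
    using eventually_nhds_in_open[of "ball 0 r" 0] \<open>r > 0\<close>
    by (auto elim!: eventually_mono simp: k(2))
  ultimately have "f has_fps_expansion fps_X * B"
    using has_fps_expansion_cong[of "\<lambda>z. z * k z" f "fps_X * B" "fps_X * B"] by simp
  then have A: "A = fps_X * B"
    using Suc.prems(4) fps_expansion_unique_complex by blast
  have "fps_nth B i = 0" if "i < p" for i
    using Suc.prems(5)[of "Suc i"] that by (simp add: A)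
  with Suc.IH[OF _ k(1) \<open>r > 0\<close> B] obtain K where K: "K holomorphic_on ball 0 r"
    "\<And>z. z \<in> ball 0 r \<Longrightarrow> k z = z ^ p * K z" "K 0 = fps_nth B p"
    by blast
  show ?case
    using Suc.prems(1)[OF K(1)] K(2,3) k(2) by (simp add: A algebra_simps)
qed

text \<open>
  On the circle of radius \<open>r\<close> the hypothesis gives the bound \<open>r ^ -p\<close> for \<open>k\<close>. The maximum principle
  spreads it over the disc, and it tends to 1 with \<open>r\<close>.
\<close>
lemma norm_cofactor_of_power_le:
  fixes k :: "complex \<Rightarrow> complex"
  assumes hol: "k holomorphic_on ball 0 1"
    and le: "\<And>z. z \<in> ball 0 1 \<Longrightarrow> norm (z ^ p * k z) \<le> 1"
    and "norm z < 1"
  shows "norm (k z) \<le> 1"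
proof -
  have bound: "norm (k z) \<le> inverse r ^ p" if r: "norm z < r" "r < 1" for r
  proof (rule maximum_modulus_frontier[where f = k and \<xi> = z and S = "cball 0 r"])
    have "0 < r" using r by (meson norm_ge_zero le_less_trans)
    have sub: "cball 0 r \<subseteq> ball (0::complex) 1" using r by auto
    show "k holomorphic_on interior (cball 0 r)"
      using hol sub interior_subset holomorphic_on_subset by blast
    show "continuous_on (closure (cball 0 r)) k"
      using continuous_on_subset[OF holomorphic_on_imp_continuous_on[OF hol] sub] by simp
    show "norm (k u) \<le> inverse r ^ p" if "u \<in> frontier (cball 0 r)" for u
    proof -
      have "norm u = r" using that \<open>0 < r\<close> by simp
      then have "r ^ p * norm (k u) \<le> 1"
        using le[of u] r by (simp add: norm_mult norm_power)
      then show ?thesis using \<open>0 < r\<close> by (simp add: field_simps)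
    qed
  qed (use r in auto)
  have lim: "((\<lambda>r. inverse r ^ p) \<longlongrightarrow> inverse 1 ^ p) (at_left (1::real))"
    by (intro tendsto_intros) auto
  have "eventually (\<lambda>r. r \<in> {norm z<..<1}) (at_left (1::real))"
    using \<open>norm z < 1\<close> by (intro eventually_at_leftI[of "norm z"]) auto
  then have "eventually (\<lambda>r. norm (k z) \<le> inverse r ^ p) (at_left (1::real))"
    by eventually_elim (use bound in auto)
  then show ?thesis
    using tendsto_lowerbound[OF lim] by simp
qed

text \<open>
  The Schwarz lemma applied to \<open>f\<close> followed by the Moebius map that takes \<open>f 0\<close> to 0. With the
  non-strict hypothesis \<open>\<bar>f\<bar> \<le> 1\<close> the lemma also covers constants of modulus 1, which do occur as
  cofactors; for \<open>\<bar>f 0\<bar> = 1\<close> the bound is just 1.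
\<close>
lemma Schwarz_Pick_at_zero:
  fixes f :: "complex \<Rightarrow> complex"
  assumes hol: "f holomorphic_on ball 0 1"
    and le: "\<And>z. z \<in> ball 0 1 \<Longrightarrow> norm (f z) \<le> 1"
    and z: "norm z < 1"
  shows "norm (f z) \<le> (norm z + norm (f 0)) / (1 + norm (f 0) * norm z)"
proof (cases "norm (f 0) = 1")
  case True
  have "1 + norm z > 0" by (simp add: add_pos_nonneg)
  with True show ?thesis using le[of z] z by (simp add: add.commute)
next
  case False
  define a where "a = f 0"
  have a: "norm a < 1" using le[of 0] False by (simp add: a_def)
  have prod: "norm (cnj a * f u) < 1" if "u \<in> ball 0 1" for u
  proof -
    have "norm (cnj a * f u) \<le> norm a * 1"
      unfolding norm_mult using le[OF that] by (intro mult_mono) auto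
    then show ?thesis using a by simp
  qed
  have nz: "1 - cnj a * f u \<noteq> 0" if "u \<in> ball 0 1" for u
    using prod[OF that] by auto
  define phi where "phi u = (f u - a) / (1 - cnj a * f u)" for u
  have hphi: "phi holomorphic_on ball 0 1"
    unfolding phi_def using nz by (intro holomorphic_intros hol) auto
  have sq: "(norm (1 - cnj a * v))\<^sup>2 - (norm (v - a))\<^sup>2 = (1 - (norm a)\<^sup>2) * (1 - (norm v)\<^sup>2)" for v
    by (simp add: cmod_power2) algebra
  have phi_le: "norm (phi u) \<le> 1" if "u \<in> ball 0 1" for u
  proof -
    have "0 \<le> (1 - (norm a)\<^sup>2) * (1 - (norm (f u))\<^sup>2)"
      using a le[OF that] by (intro mult_nonneg_nonneg) (auto simp: power_le_one)
    then have "(norm (f u - a))\<^sup>2 \<le> (norm (1 - cnj a * f u))\<^sup>2"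
      using sq[of "f u"] by linarith
    then have "norm (f u - a) \<le> norm (1 - cnj a * f u)"
      by (rule power2_le_imp_le) simp
    then show ?thesis using nz[OF that] by (simp add: phi_def norm_divide)
  qed
  have "phi 0 = 0" by (simp add: phi_def a_def)
  then obtain k where k: "k holomorphic_on ball 0 1" "\<And>u. norm u < 1 \<Longrightarrow> phi u = u * k u"
    using Schwarz3[OF hphi] by metis
  have "norm (k z) \<le> 1"
    by (rule norm_cofactor_of_power_le[of k 1]) (use k phi_le z in auto)
  then have "norm (phi z) \<le> norm z"
    using k(2)[OF z] by (simp add: norm_mult mult_left_le)
  then have main: "norm (f z - a) \<le> norm z * norm (1 - cnj a * f z)"
    using nz[of z] z by (simp add: phi_def norm_divide field_simps)
  \<comment> \<open>It remains to express the pseudo-hyperbolic bound in terms of the moduli alone.\<close>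
  define x \<alpha> r where "x = norm (f z)" and "\<alpha> = norm a" and "r = norm z"
  have bnds: "0 \<le> x" "x \<le> 1" "0 \<le> \<alpha>" "\<alpha> < 1" "0 \<le> r" "r < 1"
    using a z le[of z] by (auto simp: x_def \<alpha>_def r_def)
  have "(norm (f z - a))\<^sup>2 \<le> r\<^sup>2 * (norm (1 - cnj a * f z))\<^sup>2"
    using power_mono[OF main, of 2] by (simp add: r_def power_mult_distrib)
  with sq[of "f z"] have 1: "(1 - r\<^sup>2) * (norm (1 - cnj a * f z))\<^sup>2 \<le> (1 - \<alpha>\<^sup>2) * (1 - x\<^sup>2)"
    by (simp add: x_def \<alpha>_def algebra_simps)
  have "1 - \<alpha> * x \<le> norm (1 - cnj a * f z)"
    using norm_triangle_ineq2[of 1 "cnj a * f z"] by (simp add: norm_mult x_def \<alpha>_def)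
  moreover have ax: "0 \<le> 1 - \<alpha> * x" using bnds mult_le_one[of \<alpha> x] by simp
  ultimately have "(1 - \<alpha> * x)\<^sup>2 \<le> (norm (1 - cnj a * f z))\<^sup>2"
    by (intro power_mono) auto
  then have "(1 - r\<^sup>2) * (1 - \<alpha> * x)\<^sup>2 \<le> (1 - r\<^sup>2) * (norm (1 - cnj a * f z))\<^sup>2"
    using bnds by (intro mult_left_mono) (auto simp: power_le_one)
  with 1 have "(1 - r\<^sup>2) * (1 - \<alpha> * x)\<^sup>2 \<le> (1 - \<alpha>\<^sup>2) * (1 - x\<^sup>2)" by simp
  then have "(x - \<alpha>)\<^sup>2 \<le> (r * (1 - \<alpha> * x))\<^sup>2"
    by (simp add: algebra_simps power2_eq_square)
  then have "x - \<alpha> \<le> r * (1 - \<alpha> * x)"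
    by (rule power2_le_imp_le) (use bnds ax in simp)
  moreover have "0 < 1 + \<alpha> * r" using bnds by (simp add: add_pos_nonneg)
  ultimately have "x \<le> (r + \<alpha>) / (1 + \<alpha> * r)"
    by (simp add: field_simps)
  then show ?thesis by (simp add: x_def \<alpha>_def r_def a_def)
qed

section \<open>The tangent on a vertical strip\<close>

lemma norm_cos_sin_squared:
  fixes z :: complex
  shows "(norm (cos z))\<^sup>2 = (cos (Re z))\<^sup>2 + (sinh (Im z))\<^sup>2"
    and "(norm (sin z))\<^sup>2 = (sin (Re z))\<^sup>2 + (sinh (Im z))\<^sup>2"
proof -
  show c: "(norm (cos z))\<^sup>2 = (cos (Re z))\<^sup>2 + (sinh (Im z))\<^sup>2" for z :: complex
    by (simp add: norm_cos_squared sinh_field_def exp_minus power_divide)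
  show "(norm (sin z))\<^sup>2 = (sin (Re z))\<^sup>2 + (sinh (Im z))\<^sup>2"
    using c[of "of_real pi / 2 - z"] cos_diff[of "pi / 2" "Re z"]
    by (simp flip: sin_cos_eq)
qed

lemma cos_nonzero_strip:
  fixes z :: complex
  assumes "\<bar>Re z\<bar> < pi / 2"
  shows "cos z \<noteq> 0"
proof -
  have "cos (Re z) > 0" using assms by (intro cos_gt_zero_pi) auto
  then have "(norm (cos z))\<^sup>2 > 0"
    unfolding norm_cos_sin_squared by (intro add_pos_nonneg) auto
  then show ?thesis by auto
qed

text \<open>
  With \<open>s\<close>, \<open>c\<close> the sine and cosine of \<open>\<bar>Re z\<bar>\<close> and \<open>t = sinh (Im z)\<close>, the squared modulus of the
  tangent is \<open>(s\<^sup>2 + t\<^sup>2) / (c\<^sup>2 + t\<^sup>2)\<close>. In this strip \<open>s < c\<close>, so the quotient stays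
  below 1 and is smallest for \<open>t = 0\<close>.
\<close>
lemma
  fixes z :: complex
  assumes "\<bar>Re z\<bar> < pi / 4"
  shows norm_tan_less_one: "norm (tan z) < 1"
    and tan_abs_Re_le: "tan \<bar>Re z\<bar> \<le> norm (tan z)"
proof -
  define x where "x = \<bar>Re z\<bar>"
  have x: "0 \<le> x" "x < pi / 4" using assms by (auto simp: x_def)
  define c s t where "c = cos x" and "s = sin x" and "t = sinh (Im z)"
  have pos: "c > 0" "s \<ge> 0" unfolding c_def s_def using x
    by (auto intro!: cos_gt_zero_pi sin_ge_zero)
  have "cos (pi / 4) < c" "s < sin (pi / 4)"
    unfolding c_def s_def using x
    by (auto intro!: cos_monotone_0_pi sin_monotone_2pi)
  then have "s < c" by (simp add: cos_45 sin_45)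
  then have sc: "s\<^sup>2 < c\<^sup>2" using pos by (intro power_strict_mono) auto
  have eq: "(norm (tan z))\<^sup>2 = (s\<^sup>2 + t\<^sup>2) / (c\<^sup>2 + t\<^sup>2)"
    unfolding tan_def norm_divide power_divide norm_cos_sin_squared
    by (auto simp: c_def s_def t_def x_def abs_if)
  have ct: "c\<^sup>2 + t\<^sup>2 > 0" using pos by (intro add_pos_nonneg) auto
  have "(norm (tan z))\<^sup>2 < 1\<^sup>2" unfolding eq using sc ct by simp
  then show "norm (tan z) < 1" by (rule power2_less_imp_less) simp
  have le: "s\<^sup>2 * t\<^sup>2 \<le> c\<^sup>2 * t\<^sup>2" using sc by (intro mult_right_mono) auto
  have "(tan x)\<^sup>2 \<le> (norm (tan z))\<^sup>2"
  proof -
    have "s\<^sup>2 / c\<^sup>2 \<le> (s\<^sup>2 + t\<^sup>2) / (c\<^sup>2 + t\<^sup>2)"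
      using le ct pos by (simp add: field_simps)
    then show ?thesis
      unfolding eq by (simp add: tan_def c_def s_def power_divide)
  qed
  then show "tan \<bar>Re z\<bar> \<le> norm (tan z)"
    unfolding x_def[symmetric] by (rule power2_le_imp_le) simp
qed

text \<open>
  The bound is stated for any majorant \<open>C\<close> of the modulus of the leading coefficient because it is
  increasing in \<open>C\<close>; a majorant that does not depend on the rotation \<open>c\<close> is what the application
  to \<open>cnj c * h + c * g\<close> supplies.
\<close>
lemma abs_Re_le_arctan_strip:
  fixes F :: "complex \<Rightarrow> complex"
  assumes hol: "F holomorphic_on ball 0 1"
    and strip: "\<And>z. z \<in> ball 0 1 \<Longrightarrow> \<bar>Re (F z)\<bar> < 1"
    and A: "F has_fps_expansion A" and A0: "\<And>k. k < p \<Longrightarrow> fps_nth A k = 0"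
    and p: "p \<ge> 1" and z: "z \<in> ball 0 1"
    and C: "pi / 4 * norm (fps_nth A p) \<le> C"
  shows "\<bar>Re (F z)\<bar> \<le> 4 / pi * arctan (norm z ^ p * ((norm z + C) / (1 + C * norm z)))"
proof -
  obtain K where K: "K holomorphic_on ball 0 1" "\<And>z. z \<in> ball 0 1 \<Longrightarrow> F z = z ^ p * K z"
    "K 0 = fps_nth A p"
    using holomorphic_factor_power[OF hol _ A, of p] A0 by auto
  define T :: "complex set" where "T = {\<zeta>. \<bar>Re \<zeta>\<bar> < pi / 4}"
  have T_eq: "T = {\<zeta>. Re \<zeta> < pi / 4} \<inter> {\<zeta>. - (pi / 4) < Re \<zeta>}"
    by (auto simp: T_def)
  have T: "open T" unfolding T_eq
    by (intro open_Int open_halfspace_Re_lt open_halfspace_Re_gt)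
  have ct: "cos \<zeta> \<noteq> 0" if "\<zeta> \<in> T" for \<zeta>
    using that by (intro cos_nonzero_strip) (auto simp: T_def)
  have tan_hol: "tan holomorphic_on T"
    by (rule holomorphic_on_tan) (rule ct)
  have "(tan has_field_derivative inverse ((cos 0)\<^sup>2)) (at (0::complex))"
    by (rule DERIV_tan) simp
  then have dtan: "deriv tan (0::complex) = 1"
    by (simp add: DERIV_imp_deriv)
  \<comment> \<open>Writing \<open>tan \<zeta> = \<zeta> * S \<zeta>\<close> transfers the factor \<open>z ^ p\<close> of \<open>F\<close> to \<open>tan (pi F / 4)\<close> without
    expanding the composition; since \<open>S 0 = 1\<close>, the leading coefficient is only scaled by \<open>pi / 4\<close>.\<close>
  define S :: "complex \<Rightarrow> complex" where "S \<zeta> = (if \<zeta> = 0 then 1 else tan \<zeta> / \<zeta>)" for \<zeta>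
  have S: "S holomorphic_on T"
    by (rule pole_theorem_open_0[OF tan_hol T, of 0]) (auto simp: S_def dtan)
  have tanS: "tan \<zeta> = \<zeta> * S \<zeta>" for \<zeta> by (simp add: S_def)
  define G where "G u = complex_of_real (pi / 4) * F u" for u
  have G_hol: "G holomorphic_on ball 0 1"
    unfolding G_def by (intro holomorphic_intros hol)
  have ReG: "Re (G u) = pi / 4 * Re (F u)" for u by (simp add: G_def)
  have GT: "G u \<in> T" if "u \<in> ball 0 1" for u
    using strip[OF that] by (simp add: T_def ReG abs_mult)
  define \<psi> where "\<psi> u = complex_of_real (pi / 4) * K u * S (G u)" for u
  have psi_hol: "\<psi> holomorphic_on ball 0 1"
    unfolding \<psi>_def
    by (intro holomorphic_intros K holomorphic_on_compose_gen[OF G_hol S, unfolded o_def])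
       (use GT in auto)
  have tan_psi: "tan (G u) = u ^ p * \<psi> u" if "u \<in> ball 0 1" for u
    by (simp add: tanS \<psi>_def) (simp add: G_def K(2)[OF that])
  have psi_le: "norm (\<psi> u) \<le> 1" if "norm u < 1" for u
  proof (rule norm_cofactor_of_power_le[OF psi_hol _ that])
    show "norm (v ^ p * \<psi> v) \<le> 1" if "v \<in> ball 0 1" for v
      using norm_tan_less_one[of "G v"] GT[OF that] tan_psi[OF that] by (simp add: T_def)
  qed
  have "G 0 = 0" using K(2)[of 0] p by (simp add: G_def)
  then have psi0: "norm (\<psi> 0) = pi / 4 * norm (fps_nth A p)"
    by (simp add: \<psi>_def S_def K(3) norm_mult)
  define c where "c = norm (\<psi> 0)"
  define r where "r = norm z"
  have r: "0 \<le> r" "r < 1" using z by (auto simp: r_def)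
  have c: "0 \<le> c" "c \<le> C" using C psi0 by (auto simp: c_def)
  have "norm (\<psi> z) \<le> (r + c) / (1 + c * r)"
    unfolding c_def r_def using z psi_le by (intro Schwarz_Pick_at_zero psi_hol) auto
  also have "\<dots> \<le> (r + C) / (1 + C * r)"
  proof -
    have "0 < 1 + c * r" "0 < 1 + C * r" using c r by (auto intro!: add_pos_nonneg)
    moreover have "0 \<le> (C - c) * (1 - r * r)"
      using c r by (intro mult_nonneg_nonneg) (auto intro: mult_le_one)
    ultimately show ?thesis by (simp add: divide_le_eq le_divide_eq field_simps)
  qed
  finally have "norm (tan (G z)) \<le> r ^ p * ((r + C) / (1 + C * r))"
    unfolding tan_psi[OF z] norm_mult norm_power r_def[symmetric]
    using r by (intro mult_left_mono) auto
  moreover have Gz: "\<bar>Re (G z)\<bar> < pi / 4" using GT[OF z] by (simp add: T_def)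
  ultimately have "tan \<bar>Re (G z)\<bar> \<le> r ^ p * ((r + C) / (1 + C * r))"
    using tan_abs_Re_le by fastforce
  then have "arctan (tan \<bar>Re (G z)\<bar>) \<le> arctan (r ^ p * ((r + C) / (1 + C * r)))"
    by (simp add: arctan_le_iff)
  moreover have "arctan (tan \<bar>Re (G z)\<bar>) = \<bar>Re (G z)\<bar>"
    using Gz by (intro arctan_tan) auto
  moreover have "\<bar>Re (G z)\<bar> = pi / 4 * \<bar>Re (F z)\<bar>" by (simp add: ReG abs_mult)
  ultimately show ?thesis
    by (simp add: r_def field_simps)
qed

section \<open>The analytic and coanalytic parts of the mapping\<close>

lemma wirtinger_of_sum_cnj:
  assumes "open S" "h holomorphic_on S" "g holomorphic_on S"
    and w: "\<And>z. z \<in> S \<Longrightarrow> w z = h z + cnj (g z)" and z: "z \<in> S"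
  shows "wirtinger_z w z = deriv h z" "wirtinger_zbar w z = cnj (deriv g z)"
proof -
  have dh: "(h has_derivative (\<lambda>v. deriv h z * v)) (at z)"
    and dg: "(g has_derivative (\<lambda>v. deriv g z * v)) (at z)"
    using assms holomorphic_derivI has_field_derivative_def by metis+
  have "((\<lambda>z. h z + cnj (g z)) has_derivative (\<lambda>v. deriv h z * v + cnj (deriv g z * v))) (at z)"
    by (intro has_derivative_add dh has_derivative_cnj dg)
  then have "(w has_derivative (\<lambda>v. deriv h z * v + cnj (deriv g z * v))) (at z)"
    by (rule has_derivative_transform_within_open[OF _ \<open>open S\<close> z]) (simp add: w)
  then have "frechet_derivative w (at z) = (\<lambda>v. deriv h z * v + cnj (deriv g z * v))"
    by (rule frechet_derivative_at[symmetric])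
  then show "wirtinger_z w z = deriv h z" "wirtinger_zbar w z = cnj (deriv g z)"
    by (simp_all add: wirtinger_z_def wirtinger_zbar_def partial_x_def partial_y_def algebra_simps)
qed

text \<open>
  The relation \<open>g' = \<omega> h'\<close> is given only off the zeros of \<open>h'\<close>. Multiplied by \<open>h'\<close> it holds
  everywhere, and since formal power series form an integral domain, the nonzero factor \<open>h'\<close> cancels
  at the level of expansions. A power series divisible by \<open>h'\<close> starts no earlier than \<open>h'\<close>.
\<close>
lemma fps_coanalytic_part_vanishes:
  assumes S: "open S" "0 \<in> S" and hol: "h holomorphic_on S" "g holomorphic_on S"
    and w: "\<And>z. z \<in> S \<Longrightarrow> w z = h z + cnj (g z)"
    and sp: "sense_preserving_on S w"
    and H: "h has_fps_expansion H" "\<And>k. k < p \<Longrightarrow> fps_nth H k = 0" "H \<noteq> 0" "fps_nth H 0 = 0"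
    and G: "g has_fps_expansion G" "fps_nth G 0 = 0"
    and k: "k < p"
  shows "fps_nth G k = 0"
proof -
  obtain om where om: "om holomorphic_on S"
    and om_eq: "\<And>z. z \<in> S \<Longrightarrow> wirtinger_z w z \<noteq> 0 \<Longrightarrow> om z = second_dilatation w z"
    using sp unfolding sense_preserving_on_def by blast
  have zero: "deriv h z * (deriv g z - om z * deriv h z) = 0" if "z \<in> S" for z
    using om_eq[OF that] wirtinger_of_sum_cnj[OF S(1) hol w that]
    by (cases "deriv h z = 0") (auto simp: second_dilatation_def)
  define M where "M = fps_expansion om 0"
  have M: "om has_fps_expansion M"
    unfolding M_def using om S by (intro has_fps_expansion_fps_expansion)
  have "(\<lambda>z. deriv h z * (deriv g z - om z * deriv h z)) has_fps_expansion
      fps_deriv H * (fps_deriv G - M * fps_deriv H)"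
    by (intro fps_expansion_intros M H G)
  moreover have "eventually (\<lambda>z. deriv h z * (deriv g z - om z * deriv h z) = 0) (nhds 0)"
    using eventually_nhds_in_open[OF S] by eventually_elim (rule zero)
  ultimately have "(\<lambda>z. 0) has_fps_expansion fps_deriv H * (fps_deriv G - M * fps_deriv H)"
    using has_fps_expansion_cong by fast
  then have "fps_deriv H * (fps_deriv G - M * fps_deriv H) = 0"
    using fps_expansion_unique_complex has_fps_expansion_0 by blast
  moreover have "fps_deriv H \<noteq> 0"
    using H(3,4) by (auto simp: fps_deriv_eq_0_iff)
  ultimately have dG: "fps_deriv G = M * fps_deriv H" by simp
  show ?thesis
  proof (cases k)
    case (Suc j)
    have "fps_nth (fps_deriv G) j = 0"
      unfolding dG fps_mult_nth using H(2) k Suc by (intro sum.neutral) auto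
    then show ?thesis using Suc by (simp del: of_nat_Suc)
  qed (use G in simp)
qed

section \<open>The bound for the harmonic mapping\<close>

theorem lemma1p1:
  fixes w h g :: "complex \<Rightarrow> complex" and p :: nat and a\<^sub>p b\<^sub>p :: complex
  assumes "p \<ge> 1"
    and "h holomorphic_on ball 0 1"
    and "g holomorphic_on ball 0 1"
    and "\<And>z. z \<in> ball 0 1 \<Longrightarrow> w z = h z + cnj (g z)"
    and "harmonic_mapping_on (ball 0 1) w"
    and "sense_preserving_on (ball 0 1) w"
    and "has_zero_of_order (ball 0 1) w 0 p"
    and "w ` ball 0 1 \<subseteq> ball 0 1"
    and "a\<^sub>p = (deriv ^^ p) h 0 / fact p"
    and "b\<^sub>p = (deriv ^^ p) g 0 / fact p"
  shows "\<forall>z \<in> ball 0 1.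
    cmod (w z) \<le> 4 / pi *
      arctan (cmod z ^ p *
        ((cmod z + pi / 4 * (cmod a\<^sub>p + cmod b\<^sub>p)) /
         (1 + pi / 4 * (cmod a\<^sub>p + cmod b\<^sub>p) * cmod z)))"
proof
  fix z :: complex assume z: "z \<in> ball 0 1"
  let ?D = "ball (0::complex) 1"
  obtain h1 g1 where hol: "h1 holomorphic_on ?D" "g1 holomorphic_on ?D"
    and w1: "\<And>z. z \<in> ?D \<Longrightarrow> w z = h1 z + cnj (g1 z)"
    and zero: "h1 0 = 0" "g1 0 = 0"
    and ord: "fps_expansion h1 0 \<noteq> 0" "subdegree (fps_expansion h1 0) = p"
    using \<open>has_zero_of_order ?D w 0 p\<close> unfolding has_zero_of_order_def by blast
  define H G where "H = fps_expansion h1 0" and "G = fps_expansion g1 0"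
  have H: "h1 has_fps_expansion H" and G: "g1 has_fps_expansion G"
    unfolding H_def G_def using hol by (auto intro!: has_fps_expansion_fps_expansion[of ?D])
  have HG0: "fps_nth H 0 = 0" "fps_nth G 0 = 0"
    using zero fps_nth_fps_expansion[OF H, of 0] fps_nth_fps_expansion[OF G, of 0] by auto
  have Hlow: "fps_nth H k = 0" if "k < p" for k
    using that ord nth_less_subdegree_zero unfolding H_def by blast
  have Glow: "fps_nth G k = 0" if "k < p" for k
    by (rule fps_coanalytic_part_vanishes[OF _ _ hol w1 _ H Hlow _ _ G])
       (use HG0 ord that assms(6) in \<open>auto simp: H_def\<close>)
  \<comment> \<open>The two decompositions of \<open>w\<close> differ by constants, and \<open>p \<ge> 1\<close>, so they have the same
    \<open>p\<close>-th coefficients.\<close>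
  have same: "deriv h u = deriv h1 u" "deriv g u = deriv g1 u" if "u \<in> ?D" for u
    using wirtinger_of_sum_cnj[OF _ assms(2,3,4) that] wirtinger_of_sum_cnj[OF _ hol w1 that]
    by auto
  have hd: "(deriv ^^ p) f 0 = (deriv ^^ p) f1 0"
    if "f holomorphic_on ?D" "f1 holomorphic_on ?D" "\<And>u. u \<in> ?D \<Longrightarrow> deriv f u = deriv f1 u" for f f1
  proof -
    obtain q where q: "p = Suc q" using \<open>p \<ge> 1\<close> by (cases p) auto
    have "(deriv ^^ q) (deriv f) 0 = (deriv ^^ q) (deriv f1) 0"
      by (rule higher_deriv_transform_within_open[of _ ?D])
         (use that in \<open>auto intro!: holomorphic_deriv\<close>)
    then show ?thesis by (simp add: q funpow_Suc_right del: funpow.simps)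
  qed
  have ab: "a\<^sub>p = fps_nth H p" "b\<^sub>p = fps_nth G p"
    using hd[OF assms(2) hol(1) same(1)] hd[OF assms(3) hol(2) same(2)]
    by (simp_all add: assms(9,10) fps_nth_fps_expansion[OF H] fps_nth_fps_expansion[OF G])
  define c where "c = (if w z = 0 then 1 else w z / of_real (norm (w z)))"
  have c: "norm c = 1" "cnj c * w z = of_real (norm (w z))"
    using complex_norm_square[of "w z"]
    by (auto simp: c_def norm_divide field_simps power2_eq_square)
  define F where "F u = cnj c * h1 u + c * g1 u" for u
  have ReF: "Re (F u) = Re (cnj c * w u)" if "u \<in> ?D" for u
    by (simp add: F_def w1[OF that] algebra_simps)
  have "\<bar>Re (F z)\<bar> \<le> 4 / pi * arctan (cmod z ^ p *
        ((cmod z + pi / 4 * (cmod a\<^sub>p + cmod b\<^sub>p)) / (1 + pi / 4 * (cmod a\<^sub>p + cmod b\<^sub>p) * cmod z)))"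
  proof (rule abs_Re_le_arctan_strip)
    show "F holomorphic_on ?D" unfolding F_def by (intro holomorphic_intros hol)
    show "\<bar>Re (F u)\<bar> < 1" if "u \<in> ?D" for u
    proof -
      have "\<bar>Re (F u)\<bar> \<le> norm (cnj c * w u)" unfolding ReF[OF that] by (rule abs_Re_le_cmod)
      also have "\<dots> = norm (w u)" by (simp add: norm_mult c(1))
      also have "\<dots> < 1" using assms(8) that by (auto simp: image_subset_iff)
      finally show ?thesis .
    qed
    show "F has_fps_expansion fps_const (cnj c) * H + fps_const c * G"
      unfolding F_def by (intro fps_expansion_intros H G)
    show "fps_nth (fps_const (cnj c) * H + fps_const c * G) k = 0" if "k < p" for k
      using Hlow[OF that] Glow[OF that] by simp
    have "norm (cnj c * a\<^sub>p + c * b\<^sub>p) \<le> norm a\<^sub>p + norm b\<^sub>p"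
      by (rule norm_triangle_le) (simp add: norm_mult c(1))
    then show "pi / 4 * norm (fps_nth (fps_const (cnj c) * H + fps_const c * G) p)
        \<le> pi / 4 * (cmod a\<^sub>p + cmod b\<^sub>p)"
      by (simp add: ab)
  qed (use z \<open>p \<ge> 1\<close> in auto)
  then show "cmod (w z) \<le> 4 / pi * arctan (cmod z ^ p *
        ((cmod z + pi / 4 * (cmod a\<^sub>p + cmod b\<^sub>p)) / (1 + pi / 4 * (cmod a\<^sub>p + cmod b\<^sub>p) * cmod z)))"
    by (simp add: ReF[OF z] c(2))
qed

end
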